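(* Let $p\ge 2$ be an even integer, let $D_p(c)=(c-1)^4-4p(c+1)^2(c-p-1)$, and let $c^*$ be the unique solution of $D_p(c)=0$ in the interval $[2p+1+\sqrt{8p},\infty)$. In the multimodal linear search problem with $p$ modes, no algorithm $\mathcal{A}$ satisfies $CR_{\mathcal{A}}<c^*$.
   Context: **Problem.** A point-like searcher starts at the origin of the real line at time $0$ and moves with speed at most $1$. A stationary target is at an unknown coordinate at distance $d\ge 1$ from the origin. The searcher has $p$ search modes, and a target is detected only when the searcher passes through its location in the (unknown) correct mode. The searcher may switch direction and mode instantaneously, but needs at least $L$ time to search an interval of length $L$ for every mode used. A coordinate $x$ is *explored* by time $t$ if the searcher has passed through $x$ in each of the $p$ modes at or before time $t$. By convention every $x$ with $|x|<1$ counts as explored at time $0$. Without loss of generality the positive direction is the one in which the searcher first reaches distance $1$ from the origin. **Algorithms.** An algorithm is a pattern of motion of the searcher together with its use of modes. Infinitely precise motion is permitted (for instance, for even $p$, moving at speed $1/(p+1)$ while searching in all $p$ modes simultaneously). To determine whether a pattern of motion is valid, one imagines a scenario where motion is restricted to small, discrete steps of size $\varepsilon$, in each of which the searcher uses one search mode and moves a distance $\varepsilon$ with speed $1$ in either direction. A pattern of motion is valid if it can be approximated arbitrarily well in this restricted case as $\varepsilon$ tends to $0$. Only algorithms for which every coordinate has a finite exploration time are considered. **Competitive ratio.** For an algorithm $\mathcal{A}$ (analyzed as if it never stops), let $T_{\mathcal{A}}(x)=\inf\{t\ge 0: x \text{ is explored by time } t\}$, $CR_{\mathcal{A}}(x)=T_{\mathcal{A}}(x)/|x|$,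 and $CR_{\mathcal{A}}=\sup_x CR_{\mathcal{A}}(x)$, the supremum being effectively over $|x|\ge 1$. *)

theory Defs
  imports "HOL-Analysis.Analysis"
begin

text \<open>
  A pattern of motion with its use of modes: at time \<open>t \<ge> 0\<close> the searcher is at \<open>pos A t\<close> and
  searches there simultaneously in all modes of the set \<open>modes A t\<close>. The \<open>p\<close> modes are the
  numbers below \<open>p\<close>. Values at negative times are irrelevant throughout.
\<close>

record search_pattern =
  pos :: "real \<Rightarrow> real"
  modes :: "real \<Rightarrow> nat set"

definition passes :: "search_pattern \<Rightarrow> nat \<Rightarrow> real \<Rightarrow> real \<Rightarrow> bool" where
  "passes A i x t \<longleftrightarrow> 0 \<le> t \<and> pos A t = x \<and> i \<in> modes A t"

text \<open>
  Step \<open>k\<close> of a discrete pattern occupies the time interval from \<open>\<epsilon> * k\<close> to \<open>\<epsilon> * (k + 1)\<close>; it has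
  direction \<open>d k\<close> and uses the single mode \<open>m k\<close>. The time intervals are closed, so the end point
  of a step is searched in that step and also in the next one.
\<close>

definition discrete_pattern :: "nat \<Rightarrow> real \<Rightarrow> search_pattern \<Rightarrow> bool" where
  "discrete_pattern p \<epsilon> Q \<longleftrightarrow>
     (\<exists>(d :: nat \<Rightarrow> real) (m :: nat \<Rightarrow> nat).
        (\<forall>k. d k \<in> {-1, 1} \<and> m k < p) \<and>
        (\<forall>k. \<forall>t\<in>{\<epsilon> * real k..\<epsilon> * real (Suc k)}.
           pos Q t = \<epsilon> * (\<Sum>j<k. d j) + d k * (t - \<epsilon> * real k)) \<and>
        (\<forall>t\<ge>0. modes Q t = {m k |k. t \<in> {\<epsilon> * real k..\<epsilon> * real (Suc k)}}))"

text \<open>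
  \<open>Q\<close> approximates \<open>A\<close> up to time \<open>H\<close> with tolerance \<open>\<eta>\<close>: the positions are \<open>\<eta>\<close>-close, and
  whenever \<open>A\<close> passes a coordinate in some mode, \<open>Q\<close> passes the same coordinate in the same mode
  within time \<open>\<eta>\<close>. No spatial tolerance is allowed in the second clause, since it would let \<open>Q\<close>
  leave small gaps unsearched and thereby save a positive fraction of the time. \<open>Q\<close> may search
  more than \<open>A\<close> does: a discrete step always uses some mode, whether or not it is of any use.
\<close>

definition approximates :: "real \<Rightarrow> real \<Rightarrow> search_pattern \<Rightarrow> search_pattern \<Rightarrow> bool" where
  "approximates H \<eta> Q A \<longleftrightarrow>
     (\<forall>t\<in>{0..H}. \<bar>pos Q t - pos A t\<bar> \<le> \<eta>) \<and>
     (\<forall>i x. \<forall>t\<in>{0..H}. passes A i x t \<longrightarrow> (\<exists>t'. \<bar>t' - t\<bar> \<le> \<eta> \<and> passes Q i x t'))"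

definition valid_pattern :: "nat \<Rightarrow> search_pattern \<Rightarrow> bool" where
  "valid_pattern p A \<longleftrightarrow>
     (\<forall>H>0. \<forall>\<eta>>0. \<forall>\<^sub>F \<epsilon> in at_right 0. \<exists>Q. discrete_pattern p \<epsilon> Q \<and> approximates H \<eta> Q A)"

definition explored :: "nat \<Rightarrow> search_pattern \<Rightarrow> real \<Rightarrow> real \<Rightarrow> bool" where
  "explored p A x t \<longleftrightarrow> \<bar>x\<bar> < 1 \<or> (\<forall>i<p. \<exists>s\<le>t. passes A i x s)"

text \<open>
  That searching an interval of length \<open>L\<close> takes at least time \<open>L\<close> for every mode used is enforced
  by \<^const>\<open>valid_pattern\<close>, because a discrete step uses only one mode.
\<close>

definition search_algorithm :: "nat \<Rightarrow> search_pattern \<Rightarrow> bool" where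
  "search_algorithm p A \<longleftrightarrow>
     pos A 0 = 0 \<and> 1-lipschitz_on {0..} (pos A) \<and> (\<forall>t\<ge>0. modes A t \<subseteq> {..<p}) \<and>
     valid_pattern p A \<and> (\<forall>x. \<exists>t\<ge>0. explored p A x t)"

definition exploration_time :: "nat \<Rightarrow> search_pattern \<Rightarrow> real \<Rightarrow> real" where
  "exploration_time p A x = Inf {t. 0 \<le> t \<and> explored p A x t}"

text \<open>
  For \<open>\<bar>x\<bar> < 1\<close> the ratio is \<open>0\<close> (at \<open>x = 0\<close> because \<open>0 / 0 = 0\<close>), so the supremum below is
  effectively over \<open>\<bar>x\<bar> \<ge> 1\<close>. It may be infinite.
\<close>

definition competitive_ratio_at :: "nat \<Rightarrow> search_pattern \<Rightarrow> real \<Rightarrow> real" where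
  "competitive_ratio_at p A x = exploration_time p A x / \<bar>x\<bar>"

definition competitive_ratio :: "nat \<Rightarrow> search_pattern \<Rightarrow> ereal" where
  "competitive_ratio p A = (SUP x. ereal (competitive_ratio_at p A x))"

definition D_poly :: "nat \<Rightarrow> real \<Rightarrow> real" where
  "D_poly p c = (c - 1) ^ 4 - 4 * real p * (c + 1)\<^sup>2 * (c - real p - 1)"

definition c_star :: "nat \<Rightarrow> real" where
  "c_star p = (THE c. c \<in> {2 * real p + 1 + sqrt (8 * real p)..} \<and> D_poly p c = 0)"

end

theory Submission
  imports Defs
begin

text \<open>
  A discrete pattern is a walk with unit steps on the integers. Since \<open>p\<close> is even, a cell that the
  walk has explored and left behind between itself and the origin has been crossed at least \<open>p + 1\<close>
  times, and at least \<open>p + 2\<close> times once the walk is back at the origin; these excess crossings are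
  what a lower bound must charge for.

  Call the first unexplored cell on either side its frontier. Cut the walk into trips, on alternating
  sides: a trip starts at the last visit to \<open>0\<close> before the frontier cell on its side becomes explored.
  Consider a trip that moves the frontier from \<open>a\<close> to \<open>a''\<close> while the opposite frontier stays at \<open>a'\<close>,
  and let \<open>X\<close>, \<open>X'\<close> be the total excess before and after it. Let \<open>b\<close> be the frontier at the last
  time at which the walk is not below it. By parity \<open>X' \<ge> X + 2 b\<close>, and the deadline of cell \<open>b\<close> gives
  \<open>p (a'' + a') + X \<le> (c - 1) b\<close>, up to rounding. For \<open>W = p (a + a') + X\<close> and
  \<open>W' = p (a'' + a') + X'\<close> this yields \<open>W' \<le> (c + 1) (X' - X) / 2\<close>. The deadlines of the frontier cells,
  which must be reached from the origin, give \<open>W \<le> (c - 1) a\<close> and \<open>W' \<le> (c - 1) a'\<close>, hence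
  \<open>W + W' \<le> (c - 1) (W - X) / p\<close>. The map that these two inequalities induce on the ratio \<open>W / X\<close> has
  its fixed points at the roots of a quadratic with discriminant \<open>D_poly p c\<close>. If that is negative, the
  ratio drops by a fixed amount in every trip, although it always exceeds \<open>1\<close>.
\<close>

section \<open>Unit walks and their crossings\<close>

definition unit_walk :: "(nat \<Rightarrow> int) \<Rightarrow> bool" where
  "unit_walk V \<longleftrightarrow> V 0 = 0 \<and> (\<forall>j. \<bar>V (Suc j) - V j\<bar> = 1)"

text \<open>Cell \<open>x\<close> is the interval from \<open>x\<close> to \<open>x + 1\<close>, and
  a step crosses the cell at the smaller of its two end points. Only cells to the right of the
  origin are numbered; those to the left are read off from \<open>- V\<close>.\<close>

definition crossings :: "(nat \<Rightarrow> int) \<Rightarrow> nat \<Rightarrow> nat \<Rightarrow> nat" where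
  "crossings V x t = card {j. j < t \<and> min (V j) (V (Suc j)) = int x}"

lemma unit_walk_uminus: "unit_walk V \<Longrightarrow> unit_walk (- V)"
  by (simp add: unit_walk_def abs_minus_commute)

lemma uminus_uminus_walk: "- (- V) = (V :: nat \<Rightarrow> int)"
  by auto

lemma unit_walkD: "unit_walk V \<Longrightarrow> V (Suc j) = V j + 1 \<or> V (Suc j) = V j - 1"
  unfolding unit_walk_def by (smt (verit))

lemma unit_walk_dist:
  assumes "unit_walk V" "s \<le> t"
  shows "\<bar>V t - V s\<bar> \<le> int (t - s)"
  using assms(2)
proof (induction t rule: dec_induct)
  case (step n)
  then show ?case using unit_walkD[OF assms(1), of n] by (auto simp: of_nat_diff)
qed simp

lemma crossings_0 [simp]: "crossings V x 0 = 0"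
  by (simp add: crossings_def)

lemma crossings_Suc:
  "crossings V x (Suc t) = crossings V x t + (if min (V t) (V (Suc t)) = int x then 1 else 0)"
proof -
  have "{j. j < Suc t \<and> min (V j) (V (Suc j)) = int x} =
      {j. j < t \<and> min (V j) (V (Suc j)) = int x} \<union>
      (if min (V t) (V (Suc t)) = int x then {t} else {})"
    by (auto simp: less_Suc_eq)
  then show ?thesis
    unfolding crossings_def by (auto simp: card_insert_if)
qed

lemma crossings_mono: "s \<le> t \<Longrightarrow> crossings V x s \<le> crossings V x t"
  unfolding crossings_def by (rule card_mono) auto

lemma crossings_const:
  assumes "s \<le> t" "\<And>u. s \<le> u \<Longrightarrow> u < t \<Longrightarrow> min (V u) (V (Suc u)) \<noteq> int x"
  shows "crossings V x t = crossings V x s"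
  using assms
  by (induction t rule: dec_induct) (auto simp: crossings_Suc)

text \<open>Each crossing switches the side of the cell on which the walk is, and the walk starts at
  \<open>0\<close>, to the left of every numbered cell.\<close>

lemma odd_crossings_iff:
  assumes "unit_walk V"
  shows "odd (crossings V x t) \<longleftrightarrow> int x < V t"
proof (induction t)
  case 0
  then show ?case using assms by (simp add: unit_walk_def)
next
  case (Suc t)
  then show ?case using unit_walkD[OF assms, of t] by (auto simp: crossings_Suc)
qed

text \<open>A step crosses a single cell, and this cell is not counted both for \<open>V\<close> and
  for \<open>- V\<close>.\<close>

lemma sum_crossings_le:
  assumes "unit_walk V"
  shows "(\<Sum>x<A. crossings V x t) + (\<Sum>x<B. crossings (- V) x t) \<le> t"
proof (induction t)
  case (Suc t)
  have del: "(\<Sum>x<A. if y = int x then 1 else 0 :: nat) = (if 0 \<le> y \<and> y < int A then 1 else 0)" for A y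
  proof (cases "0 \<le> y")
    case True
    then obtain n where "y = int n" using nonneg_eq_int by blast
    then show ?thesis by (simp add: sum.delta')
  qed auto
  have "\<not> (0 \<le> min (V t) (V (Suc t)) \<and> 0 \<le> min (- V t) (- V (Suc t)))"
    using unit_walkD[OF assms, of t] by auto
  then show ?case
    using Suc by (auto simp: crossings_Suc sum.distrib del)
qed simp

lemma last_time:
  fixes s t :: nat
  assumes "P s" "\<not> P t" "s \<le> t"
  obtains u where "s \<le> u" "u < t" "P u" "\<And>v. u < v \<Longrightarrow> v \<le> t \<Longrightarrow> \<not> P v"
proof -
  let ?S = "{u. s \<le> u \<and> u \<le> t \<and> P u}"
  have fin: "finite ?S" and ne: "?S \<noteq> {}" using assms by auto
  have "Max ?S \<in> ?S" using Max_in[OF fin ne] .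
  moreover have "\<not> P v" if "Max ?S < v" "v \<le> t" for v
  proof
    assume "P v"
    then have "v \<in> ?S" using that calculation by auto
    then show False using Max_ge[OF fin] that(1) by (meson leD)
  qed
  ultimately show ?thesis
    using that[of "Max ?S"] assms by (metis (mono_tags, lifting) le_neq_implies_less mem_Collect_eq)
qed

lemma last_zero:
  assumes "unit_walk V" "0 \<le> V s" "V t < 0" "s \<le> t"
  obtains u where "s \<le> u" "u < t" "V u = 0" "\<And>v. u < v \<Longrightarrow> v \<le> t \<Longrightarrow> V v < 0"
proof -
  obtain u where u: "s \<le> u" "u < t" "0 \<le> V u" "\<And>v. u < v \<Longrightarrow> v \<le> t \<Longrightarrow> \<not> 0 \<le> V v"
    using last_time[of "\<lambda>u. 0 \<le> V u" s t] assms by (metis linorder_not_le)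
  have "V u = 0"
    using u(3) u(4)[of "Suc u"] u(2) unit_walkD[OF assms(1), of u] by auto
  then show ?thesis using that u by force
qed

section \<open>Frontiers and trips\<close>

locale frontier_walk =
  fixes p M :: nat
  assumes p_ge: "p \<ge> 2" and p_even: "even p" and M_pos: "M > 0"
begin

text \<open>Modes are forgotten here: a discrete step uses one mode, so a cell explored in all
  \<open>p\<close> modes has been crossed at least \<open>p\<close> times. The cells below
  \<open>M\<close> stand for the region that counts as explored at time 0.\<close>

definition frontier :: "(nat \<Rightarrow> int) \<Rightarrow> nat \<Rightarrow> nat" where
  "frontier V t = (LEAST x. M \<le> x \<and> crossings V x t < p)"

lemma crossings_far:
  assumes "unit_walk V" "t \<le> x"
  shows "crossings V x t = 0"
proof -
  have "crossings V x t = crossings V x 0"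
  proof (rule crossings_const)
    fix u assume "u < t"
    then show "min (V u) (V (Suc u)) \<noteq> int x"
      using unit_walk_dist[OF assms(1), of 0 u] assms by (auto simp: unit_walk_def min_def)
  qed simp
  then show ?thesis by simp
qed

lemma frontier:
  assumes "unit_walk V"
  shows M_le_frontier: "M \<le> frontier V t" and crossings_frontier: "crossings V (frontier V t) t < p"
    and frontier_le: "frontier V t \<le> max M t"
proof -
  have *: "M \<le> max M t \<and> crossings V (max M t) t < p"
    using crossings_far[OF assms, of t "max M t"] p_ge by simp
  show "M \<le> frontier V t" "crossings V (frontier V t) t < p"
    using LeastI[of "\<lambda>x. M \<le> x \<and> crossings V x t < p", OF *] by (auto simp: frontier_def)
  show "frontier V t \<le> max M t"
    unfolding frontier_def using * by (rule Least_le)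
qed

lemma crossings_ge:
  assumes "M \<le> x" "x < frontier V t"
  shows "p \<le> crossings V x t"
  using assms not_less_Least[of x "\<lambda>x. M \<le> x \<and> crossings V x t < p"]
  unfolding frontier_def by force

lemma frontier_mono:
  assumes "unit_walk V" "s \<le> t"
  shows "frontier V s \<le> frontier V t"
  using crossings_ge[of "frontier V t" V s] crossings_frontier[OF assms(1), of t]
    M_le_frontier[OF assms(1), of t] crossings_mono[OF assms(2), of V "frontier V t"]
  by linarith

lemma frontier_eq:
  assumes "unit_walk V" "s \<le> t" "crossings V (frontier V s) t < p"
  shows "frontier V t = frontier V s"
proof -
  have "frontier V t \<le> frontier V s"
    using assms crossings_ge[of "frontier V s" V t] M_le_frontier[OF assms(1), of s] by force
  then show ?thesis using frontier_mono[OF assms(1,2)] by simp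
qed

lemma first_exploration:
  assumes "unit_walk V" "crossings V x s < p" "p \<le> crossings V x t"
  obtains e where "s < e" "e \<le> t" "p \<le> crossings V x e" "\<And>u. u < e \<Longrightarrow> crossings V x u < p"
    "min (V (e - 1)) (V e) = int x"
proof -
  define e where "e = (LEAST u. p \<le> crossings V x u)"
  have e: "p \<le> crossings V x e" "\<And>u. u < e \<Longrightarrow> crossings V x u < p" "e \<le> t"
    unfolding e_def using assms(3)
    by (auto intro: LeastI_ex Least_le dest: not_less_Least)
  have "s < e" using assms(2) e(1) crossings_mono[of e s V x] by linarith
  moreover have "min (V (e - 1)) (V e) = int x"
    using e(1) e(2)[of "e - 1"] crossings_Suc[of V x "e - 1"] \<open>s < e\<close>
    by (auto split: if_splits)
  ultimately show ?thesis using that e by blast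
qed

text \<open>Cells below \<open>M\<close> may contribute negatively, as they need not be explored.\<close>

definition side_excess :: "(nat \<Rightarrow> int) \<Rightarrow> nat \<Rightarrow> int" where
  "side_excess V t = (\<Sum>x<frontier V t. int (crossings V x t) - int p)"

definition excess :: "(nat \<Rightarrow> int) \<Rightarrow> nat \<Rightarrow> int" where
  "excess V t = side_excess V t + side_excess (- V) t"

text \<open>The trip starts at time \<open>t\<close>; the cell at the frontier becomes explored exactly at time \<open>e\<close>.\<close>

definition trip :: "(nat \<Rightarrow> int) \<Rightarrow> nat \<Rightarrow> nat \<Rightarrow> bool" where
  "trip V t e \<longleftrightarrow> V t = 0 \<and> t < e \<and> p \<le> crossings V (frontier V t) e \<and>
     (\<forall>u<e. crossings V (frontier V t) u < p) \<and> (\<forall>u. t < u \<and> u \<le> e \<longrightarrow> 0 < V u)"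

lemma side_excess_eq:
  "side_excess V t = int (\<Sum>x<frontier V t. crossings V x t) - int p * int (frontier V t)"
  by (simp add: side_excess_def sum_subtractf)

lemma excess_le:
  assumes "unit_walk V"
  shows "excess V t + int p * (int (frontier V t) + int (frontier (- V) t)) \<le> int t"
  using sum_crossings_le[OF assms, where A = "frontier V t" and B = "frontier (- V) t" and t = t]
  by (simp add: excess_def side_excess_eq distrib_left flip: of_nat_le_iff[where 'a = int])

lemma excess_ge: "- (2 * int p * int M) \<le> excess V t"
proof -
  have "- (int p * int M) \<le> side_excess V t" for V
  proof -
    have "(\<Sum>x<frontier V t. if x < M then - int p else 0) \<le> side_excess V t"
      unfolding side_excess_def
      by (rule sum_mono) (use crossings_ge[of _ V t] in \<open>auto simp: not_less\<close>)
    moreover have "- (int p * int M) = (\<Sum>x<M. - int p)" by simp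
    moreover have "(\<Sum>x<M. - int p) \<le> (\<Sum>x\<in>{..<frontier V t} \<inter> {..<M}. - int p)"
      using card_mono[of "{..<M}" "{..<frontier V t} \<inter> {..<M}"] by (simp add: mult_right_mono)
    moreover have "(\<Sum>x\<in>{..<frontier V t} \<inter> {..<M}. - int p) = (\<Sum>x<frontier V t. if x < M then - int p else 0)"
      using sum.inter_restrict[of "{..<frontier V t}" "\<lambda>x. - int p" "{..<M}"] by (simp only: finite_lessThan lessThan_iff if_True)
    ultimately show ?thesis by linarith
  qed
  from this[of V] this[of "- V"] show ?thesis by (simp add: excess_def)
qed

text \<open>The next trip goes to the opposite side and ends when the frontier cell there becomes
  explored. At time \<open>s\<close> the walk is for the last time at or beyond its own frontier
  \<open>b\<close>, so cells below \<open>b\<close> have odd counts at \<open>s\<close> but even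
  counts at \<open>t\<close> and \<open>t'\<close>. Parity thus adds one to the excess of each of
  them up to \<open>s\<close>, and two up to \<open>t'\<close>.\<close>

lemma trip_step:
  assumes walk: "unit_walk V" and trip: "trip V t e"
    and T: "p \<le> crossings (- V) (frontier (- V) t) T"
  obtains t' e' s b where
    "trip (- V) t' e'" "e' \<le> T" "frontier (- V) t' = frontier (- V) t"
    "t' + frontier (- V) t \<le> e'"
    "frontier V t \<le> b" "b \<le> frontier V t'" "crossings V b s < p"
    "excess V t + int p * (int (frontier V t') + int (frontier (- V) t)) + int b - int p \<le> int s"
    "excess V t + 2 * int b \<le> excess V t'"
proof -
  define a where "a = frontier V t"
  define a' where "a' = frontier (- V) t"
  have nwalk: "unit_walk (- V)" using walk by (rule unit_walk_uminus)
  have a_pos: "M \<le> a" "M \<le> a'"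
    unfolding a_def a'_def using M_le_frontier walk nwalk by auto
  have t: "V t = 0" "t < e" "p \<le> crossings V a e" "\<And>u. u < e \<Longrightarrow> crossings V a u < p"
    "\<And>u. t < u \<Longrightarrow> u \<le> e \<Longrightarrow> 0 < V u"
    using trip unfolding trip_def a_def by auto
  \<comment> \<open>The trip stays on the positive side, so the opposite frontier cell becomes
    explored only after \<open>e\<close>.\<close>
  have "crossings (- V) a' e = crossings (- V) a' t"
  proof (rule crossings_const)
    fix u assume u: "t \<le> u" "u < e"
    then show "min ((- V) u) ((- V) (Suc u)) \<noteq> int a'"
      using t(1) t(5)[of "Suc u"] by auto
  qed (use t in simp)
  then have "crossings (- V) a' e < p"
    unfolding a'_def using crossings_frontier[OF nwalk, of t] by simp
  then obtain e' where e': "e < e'" "e' \<le> T" "p \<le> crossings (- V) a' e'"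
    "\<And>u. u < e' \<Longrightarrow> crossings (- V) a' u < p" "min ((- V) (e' - 1)) ((- V) e') = int a'"
    using first_exploration[OF nwalk, of a' e T] T unfolding a'_def by metis
  have Ve': "V e' \<le> - int a'" using e'(5) by auto
  then have "V e' < 0" using a_pos M_pos by auto
  moreover have "0 \<le> V e" "e \<le> e'" using t(2) t(5)[of e] e'(1) by auto
  ultimately obtain t' where t': "e \<le> t'" "t' < e'" "V t' = 0" "\<And>v. t' < v \<Longrightarrow> v \<le> e' \<Longrightarrow> V v < 0"
    using last_zero[OF walk] by metis
  have fa': "frontier (- V) t' = a'"
    unfolding a'_def using frontier_eq[OF nwalk, of t t'] t(2) t'(1,2) e'(4) a'_def by simp
  have trip': "trip (- V) t' e'"
    unfolding trip_def fa' using t' e' by auto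
  have dist: "t' + a' \<le> e'"
    using unit_walk_dist[OF walk, of t' e'] t'(2,3) Ve' by auto
  have fe: "frontier V (e - 1) = a"
    unfolding a_def using frontier_eq[OF walk, of t "e - 1"] t(2) t(4)[of "e - 1"] a_def by simp
  \<comment> \<open>The search for \<open>s\<close> starts at \<open>f = e - 1\<close>, where the
    frontier is still \<open>a\<close>; when cell \<open>a\<close> becomes explored at
    \<open>e\<close>, the frontier may jump past the walk.\<close>
  obtain f where f: "e = Suc f" using t(2) by (cases e) auto
  have "min (V f) (V (Suc f)) = int a"
    using t(3) t(4)[of f] crossings_Suc[of V a f] f by (auto split: if_splits)
  then have "int (frontier V f) \<le> V f" using fe f by auto
  moreover have "\<not> int (frontier V t') \<le> V t'"
    using t'(3) M_le_frontier[OF walk, of t'] M_pos by simp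
  ultimately obtain s where s: "f \<le> s" "s < t'" "int (frontier V s) \<le> V s"
    "\<And>v. s < v \<Longrightarrow> v \<le> t' \<Longrightarrow> \<not> int (frontier V v) \<le> V v"
    using last_time[of "\<lambda>s. int (frontier V s) \<le> V s" f t'] t'(1) f by (metis Suc_leD)
  define b where "b = frontier V s"
  define a'' where "a'' = frontier V t'"
  have ts: "t \<le> s" using s(1) f t(2) by simp
  have ab: "a \<le> b" "b \<le> a''"
    unfolding a_def b_def a''_def using frontier_mono[OF walk] ts s(2) by auto
  \<comment> \<open>From \<open>Suc s\<close> to \<open>t'\<close> the walk stays below its
    frontier, so the frontier cell is not crossed. Step \<open>s\<close> itself may still explore
    cell \<open>b\<close>.\<close>
  have fconst: "frontier V u = frontier V (Suc s)" if "Suc s \<le> u" "u \<le> t'" for u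
    using that
  proof (induction u rule: dec_induct)
    case (step u)
    have "V u < int (frontier V u)" using s(4)[of u] step by auto
    then have "min (V u) (V (Suc u)) \<noteq> int (frontier V u)" by auto
    then have "frontier V (Suc u) = frontier V u"
      using frontier_eq[OF walk, of u "Suc u"] crossings_frontier[OF walk, of u]
      by (simp add: crossings_Suc)
    then show ?case using step by simp
  qed simp
  \<comment> \<open>If the frontier jumps over \<open>x\<close>, it does so in step
    \<open>s\<close>. That step crosses cell \<open>b\<close> only, so \<open>x\<close> already had
    its \<open>p\<close> crossings.\<close>
  have bx: "p \<le> crossings V x s" if "b < x" "x < a''" for x
  proof -
    have a2: "a'' = frontier V (Suc s)" unfolding a''_def using fconst[of t'] s(2) by simp
    then have "frontier V (Suc s) \<noteq> frontier V s" using that b_def by auto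
    then have "p \<le> crossings V b (Suc s)"
      using frontier_eq[OF walk, of s "Suc s"] unfolding b_def by fastforce
    then have "min (V s) (V (Suc s)) = int b"
      using crossings_frontier[OF walk, of s]
      unfolding b_def crossings_Suc[of V _ s] by (simp split: if_splits)
    moreover have "p \<le> crossings V x (Suc s)"
      using that a2 ab a_pos by (intro crossings_ge) auto
    ultimately show ?thesis using that by (simp add: crossings_Suc)
  qed
  have oddS: "odd (crossings V x s)" if "x < b" for x
    using odd_crossings_iff[OF walk, of x s] that s(3) b_def by auto
  have evn: "even (crossings V x t)" "even (crossings V x t')" for x
    using odd_crossings_iff[OF walk, of x t] odd_crossings_iff[OF walk, of x t'] t(1) t'(3) by auto
  \<comment> \<open>Cells below \<open>a\<close> gain one because their parity has flipped since
    \<open>t\<close>; those from \<open>a\<close> up to \<open>b\<close> have an odd count that is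
    at least the even number \<open>p\<close>; cell \<open>b\<close> may lack up to
    \<open>p\<close>.\<close>
  have lowS: "int (crossings V x s) - int p \<ge> (if x < a then int (crossings V x t) - int p else 0)
      + (if x < b then 1 else 0) - (if x = b then int p else 0)" if "x < a''" for x
  proof -
    consider "x < a" | "a \<le> x" "x < b" | "x = b" | "b < x" by linarith
    then show ?thesis
    proof cases
      case 1
      have "crossings V x t \<noteq> crossings V x s" using oddS[of x] evn(1)[of x] 1 ab by auto
      then show ?thesis using 1 ab crossings_mono[OF ts, of V x] by auto
    next
      case 2
      have "p \<le> crossings V x s" using 2 a_pos b_def by (intro crossings_ge) auto
      moreover have "p \<noteq> crossings V x s" using oddS[of x] p_even 2 by auto
      ultimately show ?thesis using 2 by auto
    next
      case 3
      then show ?thesis using ab by auto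
    next
      case 4
      then show ?thesis using bx[of x] that ab by auto
    qed
  qed
  \<comment> \<open>The return to \<open>0\<close> flips the parity of every cell below
    \<open>b\<close> once more.\<close>
  have lowT: "int (crossings V x t') - int p \<ge> (if x < a then int (crossings V x t) - int p else 0)
      + (if x < b then 2 else 0)" if "x < a''" for x
  proof (cases "x < b")
    case True
    have "crossings V x s \<noteq> crossings V x t'" using oddS[of x] evn(2)[of x] True by auto
    then show ?thesis using True lowS[OF that] crossings_mono[of s t' V x] s(2) by auto
  next
    case False
    then have "p \<le> crossings V x t'" using that ab a_pos a''_def by (intro crossings_ge) auto
    then show ?thesis using False ab by auto
  qed
  have sa: "(\<Sum>x<a''. if x < a then int (crossings V x t) - int p else 0) = side_excess V t"
  proof -
    have "{..<a''} \<inter> {..<a} = {..<a}" using ab by auto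
    then show ?thesis
      using sum.inter_restrict[of "{..<a''}" "\<lambda>x. int (crossings V x t) - int p" "{..<a}"]
      by (simp add: side_excess_def a_def)
  qed
  have sb: "(\<Sum>x<a''. if x < b then r else 0) = r * int b" for r :: int
  proof -
    have "{..<a''} \<inter> {..<b} = {..<b}" using ab by auto
    then show ?thesis
      using sum.inter_restrict[of "{..<a''}" "\<lambda>x. r" "{..<b}"] by (simp add: mult.commute)
  qed
  have neg: "side_excess (- V) t \<le> (\<Sum>x<a'. int (crossings (- V) x u) - int p)" if "t \<le> u" for u
    unfolding side_excess_def a'_def[symmetric]
    by (intro sum_mono) (simp add: crossings_mono[OF that])
  have "side_excess V t + int b - int p \<le> (\<Sum>x<a''. int (crossings V x s) - int p)"
  proof -
    have "(\<Sum>x<a''. (if x < a then int (crossings V x t) - int p else 0)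
        + (if x < b then 1 else 0) - (if x = b then int p else 0))
        \<le> (\<Sum>x<a''. int (crossings V x s) - int p)"
      by (intro sum_mono lowS) simp
    moreover have "(\<Sum>x<a''. if x = b then int p else 0) \<le> int p" by (simp add: sum.delta)
    ultimately show ?thesis by (simp add: sum.distrib sum_subtractf sa sb)
  qed
  moreover have "(\<Sum>x<a''. int (crossings V x s) - int p) + (\<Sum>x<a'. int (crossings (- V) x s) - int p)
      + int p * (int a'' + int a') \<le> int s"
    using sum_crossings_le[OF walk, where A = a'' and B = a' and t = s]
    by (simp add: sum_subtractf distrib_left flip: of_nat_le_iff[where 'a = int])
  ultimately have sT: "excess V t + int p * (int a'' + int a') + int b - int p \<le> int s"
    using neg[OF ts] by (simp add: excess_def)
  have xT: "excess V t + 2 * int b \<le> excess V t'"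
  proof -
    have "side_excess V t + 2 * int b \<le> side_excess V t'"
    proof -
      have "(\<Sum>x<a''. (if x < a then int (crossings V x t) - int p else 0) + (if x < b then 2 else 0))
          \<le> (\<Sum>x<a''. int (crossings V x t') - int p)"
        by (intro sum_mono lowT) simp
      then show ?thesis
        by (simp add: sum.distrib sa sb side_excess_def[of V t'] a''_def[symmetric])
    qed
    then show ?thesis
      using neg[of t'] fa' t'(1) t(2) by (simp add: excess_def side_excess_def[of "- V" t'])
  qed
  have "crossings V b s < p"
    unfolding b_def by (rule crossings_frontier[OF walk])
  then show ?thesis
    by (rule that[OF trip' e'(2) fa'[unfolded a'_def] dist[unfolded a'_def] ab[unfolded a_def a''_def] _
          sT[unfolded a'_def a''_def] xT])
qed

end

section \<open>The discriminant and the ratio map\<close>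

abbreviation (input) c_min :: "nat \<Rightarrow> real" where
  "c_min p \<equiv> 2 * real p + 1 + sqrt (8 * real p)"

text \<open>Nonnegativity means that \<open>(x - 1)^4 / ((x + 1)^2 (x - p - 1))\<close> is at least
  \<open>4 p\<close>. This quotient is \<open>((x - 1) / (x + 1))^2\<close>, strictly increasing,
  times \<open>(x - 1)^2 / (x - p - 1)\<close>, nondecreasing from \<open>2 p + 1\<close> on. Both
  factors are compared after cross-multiplication.\<close>

lemma D_poly_pos_above:
  assumes "p > 0" "2 * real p + 1 \<le> x" "x < y" "0 \<le> D_poly p x"
  shows "0 < D_poly p y"
proof -
  define P where "P = real p"
  have P: "P > 0" "2 * P + 1 \<le> x" using assms by (auto simp: P_def)
  have "((x - 1) * (y + 1))\<^sup>2 < ((y - 1) * (x + 1))\<^sup>2"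
  proof (rule power_strict_mono)
    show "(x - 1) * (y + 1) < (y - 1) * (x + 1)" using assms by (simp add: algebra_simps)
  qed (use P assms in \<open>auto intro!: mult_nonneg_nonneg\<close>)
  moreover have "(x - 1)\<^sup>2 * (y - P - 1) \<le> (y - 1)\<^sup>2 * (x - P - 1)"
  proof -
    have "0 \<le> (x - 1 - 2 * P) * (y - 1)" "0 \<le> (y - 1 - 2 * P) * (x - 1)"
      using P assms by (auto intro!: mult_nonneg_nonneg)
    then have "0 \<le> (y - x) * ((x - 1) * (y - 1) - P * ((x - 1) + (y - 1)))"
      using assms by (intro mult_nonneg_nonneg) (auto simp: algebra_simps)
    then show ?thesis by (simp add: power2_eq_square algebra_simps)
  qed
  ultimately have "((x - 1) * (y + 1))\<^sup>2 * ((x - 1)\<^sup>2 * (y - P - 1))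
      < ((y - 1) * (x + 1))\<^sup>2 * ((y - 1)\<^sup>2 * (x - P - 1))"
    using P assms by (intro mult_less_le_imp_less) auto
  moreover have "4 * P * (x + 1)\<^sup>2 * (x - P - 1) * ((y + 1)\<^sup>2 * (y - P - 1))
      \<le> (x - 1) ^ 4 * ((y + 1)\<^sup>2 * (y - P - 1))"
    using P assms by (intro mult_right_mono) (auto simp: D_poly_def P_def)
  moreover have "((x - 1) * (y + 1))\<^sup>2 * ((x - 1)\<^sup>2 * (y - P - 1)) = (x - 1) ^ 4 * ((y + 1)\<^sup>2 * (y - P - 1))"
    "((y - 1) * (x + 1))\<^sup>2 * ((y - 1)\<^sup>2 * (x - P - 1)) = ((x + 1)\<^sup>2 * (x - P - 1)) * (y - 1) ^ 4"
    by algebra+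
  moreover have "4 * P * (x + 1)\<^sup>2 * (x - P - 1) * ((y + 1)\<^sup>2 * (y - P - 1))
      = ((x + 1)\<^sup>2 * (x - P - 1)) * (4 * P * (y + 1)\<^sup>2 * (y - P - 1))"
    by algebra
  ultimately have "((x + 1)\<^sup>2 * (x - P - 1)) * (4 * P * (y + 1)\<^sup>2 * (y - P - 1))
      < ((x + 1)\<^sup>2 * (x - P - 1)) * (y - 1) ^ 4"
    by linarith
  then have "4 * P * (y + 1)\<^sup>2 * (y - P - 1) < (y - 1) ^ 4"
    using P by (simp add: mult_less_cancel_left_pos zero_less_mult_iff)
  then show ?thesis by (simp add: D_poly_def P_def)
qed

lemma D_poly_c_min_neg:
  assumes "p > 0"
  shows "D_poly p (c_min p) < 0"
proof -
  \<comment> \<open>In terms of this square root the value is a polynomial with a visible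
    sign.\<close>
  define s where "s = sqrt (8 * real p)"
  have s: "s > 0" "real p = s\<^sup>2 / 8" using assms by (auto simp: s_def)
  have "c_min p = s\<^sup>2 / 4 + 1 + s" by (simp add: s_def)
  moreover have "D_poly p (s\<^sup>2 / 4 + 1 + s) = - (s ^ 3 * (s\<^sup>2 + 5 * s + 8) / 4)"
    unfolding D_poly_def s(2)
    by (simp add: power2_eq_square power3_eq_cube power4_eq_xxxx field_simps)
  ultimately have "D_poly p (c_min p) = - (s ^ 3 * (s\<^sup>2 + 5 * s + 8) / 4)"
    by (simp only:)
  then show ?thesis using s(1) by (simp add: add_pos_pos)
qed

lemma D_poly_large_pos:
  assumes "p > 0" "16 * real p + 1 \<le> c"
  shows "0 < D_poly p c"
proof -
  have c: "c - 1 \<ge> 16 * real p" "real p \<ge> 1" "2 * (c - 1) \<ge> c + 1" using assms by auto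
  then have "(c + 1)\<^sup>2 * (c - real p - 1) < (2 * (c - 1))\<^sup>2 * (c - 1)"
    by (intro mult_le_less_imp_less power_mono) auto
  then have "4 * real p * ((c + 1)\<^sup>2 * (c - real p - 1)) < 4 * real p * ((2 * (c - 1))\<^sup>2 * (c - 1))"
    using assms by (intro mult_strict_left_mono) auto
  also have "\<dots> = 16 * real p * (c - 1) ^ 3"
    by (simp only: power2_eq_square power3_eq_cube)
  also have "\<dots> \<le> (c - 1) * (c - 1) ^ 3"
    using c by (intro mult_right_mono) auto
  finally show ?thesis by (simp add: D_poly_def power_numeral_reduce algebra_simps)
qed

lemma ex1_D_poly_root:
  assumes "p > 0"
  shows "\<exists>!c. c \<in> {c_min p..} \<and> D_poly p c = 0"
proof -
  have "continuous_on {c_min p..c_min p + 16 * real p} (D_poly p)"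
    unfolding D_poly_def by (intro continuous_intros)
  moreover have "D_poly p (c_min p) \<le> 0" "0 \<le> D_poly p (c_min p + 16 * real p)"
    using D_poly_c_min_neg[OF assms] D_poly_large_pos[OF assms, of "c_min p + 16 * real p"]
      real_sqrt_ge_zero[of "8 * real p"] by simp_all
  ultimately obtain c where c: "c_min p \<le> c" "D_poly p c = 0"
    using IVT'[of "D_poly p" "c_min p" 0 "c_min p + 16 * real p"] by auto
  have less: False if "c_min p \<le> x" "D_poly p x = 0" "D_poly p y = 0" "x < y" for x y
  proof -
    have "2 * real p + 1 \<le> x" by (rule order_trans[OF _ that(1)]) simp
    then show False using D_poly_pos_above[of p x y] that assms by simp
  qed
  show ?thesis
  proof (rule ex_ex1I)
    show "\<exists>c. c \<in> {c_min p..} \<and> D_poly p c = 0" using c by auto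
    show "x = y" if "x \<in> {c_min p..} \<and> D_poly p x = 0" "y \<in> {c_min p..} \<and> D_poly p y = 0" for x y
      using less[of x y] less[of y x] that by (cases x y rule: linorder_cases) auto
  qed
qed

text \<open>A nonnegative value before the root would, by \<open>D_poly_pos_above\<close>, make the
  value at the root positive.\<close>

lemma c_star:
  assumes "p > 0"
  shows "c_min p < c_star p" and "c_min p \<le> c \<Longrightarrow> c < c_star p \<Longrightarrow> D_poly p c < 0"
proof -
  have *: "c_star p \<in> {c_min p..} \<and> D_poly p (c_star p) = 0"
    unfolding c_star_def by (rule theI'[OF ex1_D_poly_root[OF assms]])
  then show "c_min p < c_star p" using D_poly_c_min_neg[OF assms] by (auto simp: less_le)
  show "D_poly p c < 0" if "c_min p \<le> c" "c < c_star p"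
    using D_poly_pos_above[of p c "c_star p"] * assms that real_sqrt_ge_zero[of "8 * real p"]
    by fastforce
qed

text \<open>\<open>X, W\<close> and \<open>X', W'\<close> stand for the excess and the load before and after a trip.\<close>

definition ratio_contracts :: "nat \<Rightarrow> real \<Rightarrow> real \<Rightarrow> bool" where
  "ratio_contracts p c \<delta> \<longleftrightarrow> (\<forall>q X W X' W'.
     0 < X \<longrightarrow> X \<le> W \<longrightarrow> W \<le> q * X \<longrightarrow> q \<le> (c + 1) / 2 \<longrightarrow> X \<le> X' \<longrightarrow>
     real p * (W + W') \<le> (c - 1) * (W - X) \<longrightarrow> 2 * W' \<le> (c + 1) * (X' - X) \<longrightarrow> W' \<le> (q - \<delta>) * X')"

text \<open>The hypotheses give \<open>W' \<le> w * X\<close> with \<open>w\<close> affine in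
  \<open>q\<close>, and \<open>X + 2 * W' / (c + 1) \<le> X'\<close>. A decrease of the ratio
  therefore amounts to positivity of \<open>q * (1 + 2 * w / (c + 1)) - w\<close>, a quadratic in
  \<open>q\<close> whose minimum is a positive multiple of \<open>- D_poly p c\<close>.\<close>

lemma ratio_decrease:
  assumes p: "p > 0" and c: "real p + 1 < c" and D: "D_poly p c < 0"
  obtains \<delta> where "\<delta> > 0" "ratio_contracts p c \<delta>"
proof -
  define P where "P = real p"
  define \<kappa> where "\<kappa> = (c - 1) / P - 1"
  \<comment> \<open>\<open>\<delta>'\<close> is that minimum, and \<open>1 + \<kappa>\<close> bounds
    the factor \<open>1 + 2 * w / (c + 1)\<close>. The cap 1 keeps \<open>q - \<delta>\<close>
    nonnegative, since \<open>q\<close> is at least 1.\<close>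
  define \<delta>' where "\<delta>' = - D_poly p c / (8 * (c - 1 - P) * (P * (c + 1)))"
  define \<delta> where "\<delta> = min 1 (\<delta>' / (1 + \<kappa>))"
  have P: "P > 0" "P + 1 < c" using p c by (auto simp: P_def)
  have \<kappa>: "\<kappa> > 0" using P by (simp add: \<kappa>_def)
  have \<delta>': "\<delta>' > 0" unfolding \<delta>'_def using P D by (intro divide_pos_pos mult_pos_pos) auto
  have \<delta>: "\<delta> > 0" "\<delta> \<le> 1" "\<delta> * (1 + \<kappa>) \<le> \<delta>'"
    using \<delta>' \<kappa> pos_le_divide_eq[of "1 + \<kappa>" \<delta> \<delta>'] by (auto simp: \<delta>_def)
  show ?thesis
  proof (rule that[OF \<delta>(1)], unfold ratio_contracts_def, intro allI impI)
    fix q X W X' W' :: real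
    assume X: "0 < X" "X \<le> W" "W \<le> q * X" and q: "q \<le> (c + 1) / 2" and X': "X \<le> X'"
      and W: "real p * (W + W') \<le> (c - 1) * (W - X)" and W': "2 * W' \<le> (c + 1) * (X' - X)"
    have "1 * X \<le> q * X" using X by linarith
    then have q1: "1 \<le> q" using X(1) by (simp add: mult_le_cancel_right)
    define w where "w = \<kappa> * q - (\<kappa> + 1)"
    \<comment> \<open>Multiplying by \<open>v \<ge> 0\<close> replaces a division by
      \<open>1 + 2 * w / (c + 1)\<close>, so the signs of \<open>w\<close> and \<open>W'\<close> do
      not matter.\<close>
    define v where "v = 1 - 2 * (q - \<delta>) / (c + 1)"
    have "P * W' \<le> (c - 1 - P) * W - (c - 1) * X"
      using W by (simp add: P_def algebra_simps)
    then have "W' \<le> ((c - 1 - P) * W - (c - 1) * X) / P"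
      using P by (simp add: pos_le_divide_eq mult.commute)
    also have "\<dots> = \<kappa> * W - (\<kappa> + 1) * X"
      using P by (simp add: \<kappa>_def field_simps)
    also have "\<dots> \<le> w * X"
      using mult_left_mono[OF X(3), of \<kappa>] \<kappa> by (simp add: w_def algebra_simps)
    finally have W'w: "W' \<le> w * X" .
    have v: "0 \<le> v" using q \<delta> P by (simp add: v_def field_simps)
    \<comment> \<open>completing the square in the quadratic that decides whether the ratio map has a fixed point\<close>
    have disc: "q * (1 + 2 * w / (c + 1)) - w = \<delta>' +
        (4 * (c - 1 - P) * q + (2 * P * (c + 1) - (c - 1) * (c + 3)))\<^sup>2 / (8 * (c - 1 - P) * (P * (c + 1)))"
    proof -
      define a where "a = c - 1 - P"
      have nz: "a \<noteq> 0" "P \<noteq> 0" "c + 1 \<noteq> 0" using P by (auto simp: a_def)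
      define r where "r = 2 * w / (c + 1)"
      have "\<kappa> * P = a" "w * P = a * q - (c - 1)"
        using nz by (simp_all add: a_def w_def \<kappa>_def field_simps)
      moreover have "r * (c + 1) = 2 * w" using nz by (simp add: r_def)
      ultimately have "(q * (1 + r) - w) * (8 * a * (P * (c + 1)))
          = - D_poly p c + (4 * a * q + (2 * P * (c + 1) - (c - 1) * (c + 3)))\<^sup>2"
        unfolding D_poly_def P_def[symmetric] a_def by algebra
      then have "q * (1 + r) - w
          = (- D_poly p c + (4 * a * q + (2 * P * (c + 1) - (c - 1) * (c + 3)))\<^sup>2) / (8 * a * (P * (c + 1)))"
        by (rule iffD2[OF nonzero_eq_divide_eq, rotated]) (use nz in simp)
      then show ?thesis unfolding r_def \<delta>'_def a_def add_divide_distrib .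
    qed
    have "0 \<le> (4 * (c - 1 - P) * q + (2 * P * (c + 1) - (c - 1) * (c + 3)))\<^sup>2 / (8 * (c - 1 - P) * (P * (c + 1)))"
      using P by (intro divide_nonneg_nonneg mult_nonneg_nonneg) auto
    then have h: "\<delta>' \<le> q * (1 + 2 * w / (c + 1)) - w" using disc by linarith
    have "2 * w \<le> \<kappa> * (c + 1)"
      unfolding w_def using mult_left_mono[OF q, of \<kappa>] \<kappa> by (simp add: algebra_simps)
    then have "1 + 2 * w / (c + 1) \<le> 1 + \<kappa>" using P by (simp add: pos_divide_le_eq)
    then have "\<delta> * (1 + 2 * w / (c + 1)) \<le> \<delta>'"
      using \<delta> mult_left_mono[of "1 + 2 * w / (c + 1)" "1 + \<kappa>" \<delta>] by linarith
    moreover have "w * v = q - \<delta> - (q * (1 + 2 * w / (c + 1)) - w - \<delta> * (1 + 2 * w / (c + 1)))"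
      unfolding v_def by (simp add: algebra_simps diff_divide_distrib)
    ultimately have "w * v \<le> q - \<delta>" using h by linarith
    then have "w * v * X \<le> (q - \<delta>) * X" using X by (intro mult_right_mono) auto
    moreover have "W' * v \<le> w * X * v" using W'w v by (rule mult_right_mono)
    ultimately have "W' * v \<le> (q - \<delta>) * X" by (simp add: mult_ac)
    moreover have "W' * v = W' - (q - \<delta>) * (2 * W' / (c + 1))"
      unfolding v_def by (simp add: right_diff_distrib mult_ac)
    ultimately have "W' \<le> (q - \<delta>) * (X + 2 * W' / (c + 1))"
      by (simp add: distrib_left)
    also have "\<dots> \<le> (q - \<delta>) * X'"
    proof (rule mult_left_mono)
      have "2 * W' / (c + 1) \<le> X' - X"
        using W' P by (simp add: pos_divide_le_eq mult.commute)
      then show "X + 2 * W' / (c + 1) \<le> X'" by simp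
    qed (use q1 \<delta> in simp)
    finally show "W' \<le> (q - \<delta>) * X'" .
  qed
qed

section \<open>Iterating trips\<close>

context frontier_walk
begin

definition load :: "(nat \<Rightarrow> int) \<Rightarrow> nat \<Rightarrow> int" where
  "load V t = excess V t + int p * (int (frontier V t) + int (frontier (- V) t))"

lemma excess_uminus: "excess (- V) t = excess V t"
  by (simp add: excess_def uminus_uminus_walk)

lemma load_uminus: "load (- V) t = load V t"
  by (simp add: load_def excess_uminus uminus_uminus_walk)

text \<open>The slack between the deadline factor \<open>c\<^sub>0\<close> and \<open>c\<close>
  absorbs the rounding term \<open>p\<close> of \<open>trip_step\<close>, because \<open>b\<close>
  is at least \<open>M\<close>. Deadlines are required only up to \<open>K\<close>, as a discrete
  walk imitates the algorithm for a bounded time only.\<close>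

lemma trip_bounds:
  fixes c c\<^sub>0 K :: real
  assumes walk: "unit_walk V" and trip: "trip V t e"
    and c: "1 \<le> c\<^sub>0" "c\<^sub>0 \<le> c" "real p \<le> (c - c\<^sub>0) * real M"
    and deadlines: "\<forall>U\<in>{V, - V}. \<forall>x. M \<le> x \<and> real x \<le> K \<longrightarrow>
      (\<exists>T. real T \<le> c\<^sub>0 * real x \<and> p \<le> crossings U x T)"
    and K: "c * real (frontier (- V) t) \<le> K"
  obtains t' e' where
    "trip (- V) t' e'" "frontier (- V) t' = frontier (- V) t"
    "real (frontier V t') \<le> c * real (frontier (- V) t)"
    "real_of_int (load V t') \<le> (c - 1) * real (frontier (- V) t)"
    "2 * real_of_int (load V t') \<le> (c + 1) * real_of_int (excess V t' - excess V t)"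
    "excess V t + 2 * int M \<le> excess V t'"
proof -
  let ?a' = "frontier (- V) t"
  have deadline: "\<exists>T. real T \<le> c\<^sub>0 * real x \<and> p \<le> crossings U x T"
    if "U \<in> {V, - V}" "M \<le> x" "real x \<le> K" for U x
    using deadlines that by blast
  have Ma': "M \<le> ?a'" using M_le_frontier[OF unit_walk_uminus[OF walk]] .
  have ca': "real ?a' \<le> c * real ?a'" using mult_right_mono[of 1 c "real ?a'"] c by simp
  then obtain T where T: "real T \<le> c\<^sub>0 * real ?a'" "p \<le> crossings (- V) ?a' T"
    using deadline[of "- V" ?a'] Ma' K by auto
  obtain t' e' s b where step: "trip (- V) t' e'" "e' \<le> T" "frontier (- V) t' = ?a'"
    "t' + ?a' \<le> e'" "frontier V t \<le> b" "b \<le> frontier V t'" "crossings V b s < p"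
    "excess V t + int p * (int (frontier V t') + int ?a') + int b - int p \<le> int s"
    "excess V t + 2 * int b \<le> excess V t'"
    using trip_step[OF walk trip T(2)] by metis
  have "c\<^sub>0 * real ?a' \<le> c * real ?a'" using c by (intro mult_right_mono) auto
  \<comment> \<open>After \<open>t'\<close> the walk needs at least \<open>frontier (- V) t\<close>
    steps to reach the opposite frontier.\<close>
  then have t': "real t' + real ?a' \<le> c * real ?a'" using step(2,4) T(1) by linarith
  have a'': "real (frontier V t') \<le> c * real ?a'"
    using frontier_le[OF walk, of t'] Ma' ca' t' by (simp add: max_def split: if_splits)
  have "load V t' \<le> int t'" using excess_le[OF walk, of t'] by (simp add: load_def)
  then have lt: "real_of_int (load V t') \<le> (c - 1) * real ?a'" using t' by (simp add: algebra_simps)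
  have Mb: "M \<le> b" using M_le_frontier[OF walk, of t] step(5) by simp
  then obtain T' where T': "real T' \<le> c\<^sub>0 * real b" "p \<le> crossings V b T'"
    using deadline[of V b] step(6) a'' K by auto
  \<comment> \<open>Cell \<open>b\<close> is still unexplored at \<open>s\<close>.\<close>
  have "s \<le> T'" using crossings_mono[of T' s V b] T'(2) step(7) by linarith
  then have s: "real s \<le> c\<^sub>0 * real b" using T'(1) by linarith
  have "real p \<le> (c - c\<^sub>0) * real b"
    using c(3) mult_left_mono[of "real M" "real b" "c - c\<^sub>0"] Mb c(2) by simp
  moreover have "real_of_int (excess V t + int p * (int (frontier V t') + int ?a')) + real b - real p \<le> real s"
    using step(8) by linarith
  ultimately have "real_of_int (excess V t + int p * (int (frontier V t') + int ?a')) \<le> (c - 1) * real b"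
    using s by (simp add: algebra_simps)
  moreover have "real_of_int (load V t') = real_of_int (excess V t + int p * (int (frontier V t') + int ?a'))
      + real_of_int (excess V t' - excess V t)"
    by (simp add: load_def step(3))
  ultimately have "2 * real_of_int (load V t') \<le> (c - 1) * (2 * real b) + 2 * real_of_int (excess V t' - excess V t)"
    by simp
  also have "\<dots> \<le> (c - 1) * real_of_int (excess V t' - excess V t) + 2 * real_of_int (excess V t' - excess V t)"
    using step(9) c by (intro add_right_mono mult_left_mono) linarith+
  also have "\<dots> = (c + 1) * real_of_int (excess V t' - excess V t)"
    by (simp add: algebra_simps)
  finally have "2 * real_of_int (load V t') \<le> (c + 1) * real_of_int (excess V t' - excess V t)" .
  moreover have "excess V t + 2 * int M \<le> excess V t'" using step(9) Mb by simp
  ultimately show ?thesis by (rule that[OF step(1,3) a'' lt])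
qed

lemma first_trip:
  fixes c\<^sub>0 :: real
  assumes walk: "unit_walk V" and T: "real T \<le> c\<^sub>0 * real M" "p \<le> crossings V M T"
  obtains t e where "trip V t e" "frontier V t = M" "real t + real M \<le> c\<^sub>0 * real M"
proof -
  obtain e where e: "0 < e" "e \<le> T" "p \<le> crossings V M e" "\<And>u. u < e \<Longrightarrow> crossings V M u < p"
    "min (V (e - 1)) (V e) = int M"
    using first_exploration[OF walk, of M 0 T] T(2) p_ge by auto
  have "0 \<le> (- V) 0" "(- V) e < 0" using walk e(5) M_pos by (auto simp: unit_walk_def)
  then obtain t where t: "t < e" "V t = 0" "\<And>v. t < v \<Longrightarrow> v \<le> e \<Longrightarrow> V v > 0"
    using last_zero[OF unit_walk_uminus[OF walk], of 0 e] by auto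
  have "frontier V 0 = M"
    using M_le_frontier[OF walk, of 0] crossings_ge[of M V 0] p_ge by force
  then have M: "frontier V t = M"
    using frontier_eq[OF walk, of 0 t] e(4)[of t] t(1) by simp
  have "t + M \<le> e" using unit_walk_dist[OF walk, of t e] t(1,2) e(5) by auto
  then show ?thesis
    using that[of t e] M t e T(1) by (simp add: trip_def)
qed

lemma no_fast_walk:
  fixes c c\<^sub>0 \<delta> :: real
  assumes walk: "unit_walk V" and c: "1 \<le> c\<^sub>0" "c\<^sub>0 \<le> c" "real p \<le> (c - c\<^sub>0) * real M"
    and deadline: "\<And>U x. U \<in> {V, - V} \<Longrightarrow> M \<le> x \<Longrightarrow> real x \<le> c ^ (n + 1) * real M \<Longrightarrow>
      \<exists>T. real T \<le> c\<^sub>0 * real x \<and> p \<le> crossings U x T"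
    and decrease: "ratio_contracts p c \<delta>"
    and \<delta>: "\<delta> > 0" "p < n" "(c + 1) / 2 \<le> (real n - real p - 1) * \<delta>"
  shows False
proof -
  have cp: "c ^ k * real M \<le> c ^ m * real M" if "k \<le> m" for k m
    using that c by (intro mult_right_mono power_increasing) auto
  \<comment> \<open>\<open>k\<close> counts completed trips. The excess starts no lower than
    \<open>- 2 * p * M\<close> and gains \<open>2 * M\<close> per trip, so it is positive once
    \<open>k > p\<close>; only then is its ratio to the load bounded. The powers of \<open>c\<close>
    keep the frontiers in the range of the deadlines.\<close>
  define I where "I k U t \<longleftrightarrow> (\<exists>e. trip U t e) \<and> real_of_int (load U t) \<le> (c - 1) * real (frontier U t) \<and>
      real (frontier U t) \<le> c ^ (k + 1) * real M \<and> real (frontier (- U) t) \<le> c ^ (k + 1) * real M \<and>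
      2 * int M * (int k - int p) \<le> excess U t \<and>
      (p < k \<longrightarrow> real_of_int (load U t) \<le> ((c + 1) / 2 - (real k - real p - 1) * \<delta>) * real_of_int (excess U t))"
    for k U t
  have "\<exists>U\<in>{V, - V}. \<exists>t. I k U t"
    if "k \<le> n" for k
    using that
  proof (induction k)
    case 0
    have cM: "real M \<le> c * real M" "c\<^sub>0 * real M \<le> c * real M"
      using cp[of 0 1] c mult_right_mono[of c\<^sub>0 c "real M"] by auto
    obtain T where "real T \<le> c\<^sub>0 * real M" "p \<le> crossings V M T"
      using deadline[of V M] cp[of 0 "n + 1"] by auto
    then obtain t e where t: "trip V t e" "frontier V t = M" "real t + real M \<le> c\<^sub>0 * real M"
      using first_trip[OF walk] by metis
    have "load V t \<le> int t" using excess_le[OF walk, of t] by (simp add: load_def)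
    then have "real_of_int (load V t) \<le> (c - 1) * real M" using t(3) cM by (simp add: algebra_simps)
    moreover have "real (frontier (- V) t) \<le> c * real M"
    proof -
      have "real (frontier (- V) t) \<le> real M \<or> real (frontier (- V) t) \<le> real t"
        using frontier_le[OF unit_walk_uminus[OF walk], of t] by auto
      then show ?thesis using t(3) cM by linarith
    qed
    moreover have "2 * int M * (int 0 - int p) \<le> excess V t"
      using excess_ge[of V t] by (simp add: mult_ac)
    ultimately have "I 0 V t" unfolding I_def using t cM by auto
    then show ?case by blast
  next
    case (Suc k)
    then obtain U t where "U \<in> {V, - V}" "I k U t" using Suc_leD by blast
    then obtain e where U: "U \<in> {V, - V}" "trip U t e"
      "real_of_int (load U t) \<le> (c - 1) * real (frontier U t)"
      "real (frontier U t) \<le> c ^ (k + 1) * real M" "real (frontier (- U) t) \<le> c ^ (k + 1) * real M"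
      "2 * int M * (int k - int p) \<le> excess U t"
      "p < k \<Longrightarrow> real_of_int (load U t) \<le> ((c + 1) / 2 - (real k - real p - 1) * \<delta>) * real_of_int (excess U t)"
      unfolding I_def by blast
    have walkU: "unit_walk U" using U(1) walk unit_walk_uminus by auto
    have UV: "{U, - U} = {V, - V}" using U(1) uminus_uminus_walk[of V] by auto
    have step1: "c * real (frontier (- U) t) \<le> c ^ (k + 2) * real M"
      using mult_left_mono[OF U(5), of c] c by (simp add: mult_ac)
    then have Kn: "c * real (frontier (- U) t) \<le> c ^ (n + 1) * real M"
      using cp[of "k + 2" "n + 1"] Suc.prems by linarith
    have "\<forall>U'\<in>{U, - U}. \<forall>x. M \<le> x \<and> real x \<le> c ^ (n + 1) * real M \<longrightarrow>
      (\<exists>T. real T \<le> c\<^sub>0 * real x \<and> p \<le> crossings U' x T)"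
      unfolding UV using deadline by blast
    then obtain t' e' where t': "trip (- U) t' e'" "frontier (- U) t' = frontier (- U) t"
      "real (frontier U t') \<le> c * real (frontier (- U) t)"
      "real_of_int (load U t') \<le> (c - 1) * real (frontier (- U) t)"
      "2 * real_of_int (load U t') \<le> (c + 1) * real_of_int (excess U t' - excess U t)"
      "excess U t + 2 * int M \<le> excess U t'"
      using trip_bounds[OF walkU U(2) c _ Kn] by metis
    have mono: "real (frontier (- U) t) \<le> c * real (frontier (- U) t)"
      using mult_right_mono[of 1 c "real (frontier (- U) t)"] c by simp
    have X: "2 * int M * (int (Suc k) - int p) \<le> excess U t'"
      using t'(6) U(6) by (simp add: algebra_simps)
    have "real_of_int (load U t') \<le> ((c + 1) / 2 - (real (Suc k) - real p - 1) * \<delta>) * real_of_int (excess U t')"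
      if "p < Suc k"
    proof (cases "k = p")
      \<comment> \<open>After \<open>p\<close> trips the excess is nonnegative, which yields the
        initial ratio bound \<open>(c + 1) / 2\<close>.\<close>
      case True
      then have "0 \<le> (c + 1) * real_of_int (excess U t)" using U(6) c by simp
      then show ?thesis using t'(5) True by (simp add: algebra_simps)
    next
      case False
      then have k: "p < k" using that by simp
      let ?q = "(c + 1) / 2 - (real k - real p - 1) * \<delta>"
      have "0 < 2 * int M * (int k - int p)" using k M_pos by simp
      then have X0: "0 < excess U t" using U(6) by linarith
      have "real_of_int (load U t') \<le> (?q - \<delta>) * real_of_int (excess U t')"
      proof (rule decrease[unfolded ratio_contracts_def, rule_format])
        show "real_of_int (excess U t) \<le> real_of_int (load U t)" by (simp add: load_def)
        show "real_of_int (excess U t) \<le> real_of_int (excess U t')" using t'(6) by simp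
        have "real p * (real_of_int (load U t) + real_of_int (load U t'))
            \<le> real p * ((c - 1) * (real (frontier U t) + real (frontier (- U) t)))"
          using U(3) t'(4) by (intro mult_left_mono) (simp_all add: distrib_left)
        also have "\<dots> = (c - 1) * (real_of_int (load U t) - real_of_int (excess U t))"
          by (simp add: load_def mult_ac)
        finally show "real p * (real_of_int (load U t) + real_of_int (load U t'))
            \<le> (c - 1) * (real_of_int (load U t) - real_of_int (excess U t))" .
        show "2 * real_of_int (load U t') \<le> (c + 1) * (real_of_int (excess U t') - real_of_int (excess U t))"
          using t'(5) by simp
        have "0 \<le> (real k - real p - 1) * \<delta>" using k \<delta>(1) by (intro mult_nonneg_nonneg) auto
        then show "?q \<le> (c + 1) / 2" by linarith
      qed (use X0 U(7) k in simp_all)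
      then show ?thesis by (simp add: algebra_simps)
    qed
    moreover have "real (frontier (- U) t') \<le> c ^ (Suc k + 1) * real M"
      "real (frontier U t') \<le> c ^ (Suc k + 1) * real M"
      using t'(2,3) step1 mono by simp_all
    ultimately have "I (Suc k) (- U) t'"
      unfolding I_def load_uminus excess_uminus uminus_uminus_walk
      using t'(1,2,4) X by metis
    moreover have "- U \<in> {V, - V}" using UV by auto
    ultimately show ?case by blast
  qed
  from this[of n] obtain U t where U: "2 * int M * (int n - int p) \<le> excess U t"
    "real_of_int (load U t) \<le> ((c + 1) / 2 - (real n - real p - 1) * \<delta>) * real_of_int (excess U t)"
    using \<delta>(2) unfolding I_def by blast
  \<comment> \<open>After \<open>n\<close> trips the ratio bound is at most 0, although the load is
    at least the positive excess.\<close>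
  have "0 < 2 * int M * (int n - int p)" using \<delta> M_pos by simp
  then have X0: "0 < excess U t" using U(1) by linarith
  then have "((c + 1) / 2 - (real n - real p - 1) * \<delta>) * real_of_int (excess U t) \<le> 0"
    using \<delta>(3) by (intro mult_nonpos_nonneg) auto
  moreover have "excess U t \<le> load U t" by (simp add: load_def)
  ultimately show False using U(2) X0 by linarith
qed

end

section \<open>From search algorithms to walks\<close>

text \<open>The midpoint of a cell lies in no other cell, so passing it forces a crossing of this
  cell; one mode per step makes \<open>p\<close> modes need \<open>p\<close> distinct steps. The
  sign \<open>\<sigma>\<close> lets one walk serve both sides.\<close>

lemma discrete_pattern_crossings:
  fixes p :: nat and \<epsilon> :: real
  assumes "\<epsilon> > 0" "p > 0" "discrete_pattern p \<epsilon> Q"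
  obtains V where "unit_walk V"
    "\<forall>\<sigma> U x \<tau>. (\<sigma> = 1 \<and> U = V \<or> \<sigma> = -1 \<and> U = - V) \<and>
      (\<forall>i<p. \<exists>t\<le>\<tau>. passes Q i (\<sigma> * (\<epsilon> * (real x + 1 / 2))) t) \<longrightarrow>
      (\<exists>T. real T \<le> \<tau> / \<epsilon> + 1 \<and> p \<le> crossings U x T)"
proof -
  obtain d :: "nat \<Rightarrow> real" and m :: "nat \<Rightarrow> nat" where dm:
    "\<forall>k. d k \<in> {-1, 1} \<and> m k < p"
    "\<forall>k. \<forall>t\<in>{\<epsilon> * real k..\<epsilon> * real (Suc k)}.
       pos Q t = \<epsilon> * (\<Sum>j<k. d j) + d k * (t - \<epsilon> * real k)"
    "\<forall>t\<ge>0. modes Q t = {m k |k. t \<in> {\<epsilon> * real k..\<epsilon> * real (Suc k)}}"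
    using assms(3) unfolding discrete_pattern_def by (elim exE conjE) (rule that)
  have d: "d k \<in> {-1, 1}" for k using dm(1) by blast
  define V where "V = (\<lambda>k. \<Sum>j<k. \<lfloor>d j\<rfloor>)"
  have fd: "real_of_int \<lfloor>d k\<rfloor> = d k" for k
  proof -
    have "d k = real_of_int (- 1) \<or> d k = real_of_int 1" using d[of k] by auto
    then show ?thesis by (elim disjE) (simp_all only: floor_of_int)
  qed
  have V: "real_of_int (V k) = (\<Sum>j<k. d j)" for k by (simp add: V_def fd)
  have walk: "unit_walk V"
    unfolding unit_walk_def
  proof (intro conjI allI)
    fix j
    have "real_of_int (V (Suc j) - V j) = d j" by (simp add: V_def fd)
    then have "real_of_int \<bar>V (Suc j) - V j\<bar> = 1" using d[of j] by auto
    then show "\<bar>V (Suc j) - V j\<bar> = 1" by linarith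
  qed (simp add: V_def)
  show ?thesis
  proof (rule that[OF walk], intro allI impI, elim conjE)
    fix \<sigma> :: real and U x and \<tau> :: real
    assume \<sigma>: "\<sigma> = 1 \<and> U = V \<or> \<sigma> = -1 \<and> U = - V"
      and passes: "\<forall>i<p. \<exists>t\<le>\<tau>. passes Q i (\<sigma> * (\<epsilon> * (real x + 1 / 2))) t"
    \<comment> \<open>A step that contains a time up to \<open>\<tau>\<close> may end later, hence
      the extra one.\<close>
    define T where "T = Suc (nat \<lfloor>\<tau> / \<epsilon>\<rfloor>)"
    have "0 \<le> \<tau>" using passes assms(2) unfolding passes_def by (meson order_trans)
    then have T: "real T \<le> \<tau> / \<epsilon> + 1" using assms(1) by (simp add: T_def)
    have "\<exists>k<T. m k = i \<and> min (U k) (U (Suc k)) = int x" if i: "i < p" for i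
    proof -
      obtain t where t: "t \<le> \<tau>" "0 \<le> t" "pos Q t = \<sigma> * (\<epsilon> * (real x + 1 / 2))" "i \<in> modes Q t"
        using passes i unfolding passes_def by blast
      then obtain k where k: "m k = i" "\<epsilon> * real k \<le> t" "t \<le> \<epsilon> * real (Suc k)"
        using dm(3) t(2) by auto
      define \<theta> where "\<theta> = (t - \<epsilon> * real k) / \<epsilon>"
      have \<theta>: "0 \<le> \<theta>" "\<theta> \<le> 1" "t - \<epsilon> * real k = \<epsilon> * \<theta>"
        using k assms(1) by (auto simp: \<theta>_def field_simps)
      have "\<epsilon> * (\<sigma> * (real x + 1 / 2)) = \<epsilon> * (real_of_int (V k) + d k * \<theta>)"
        using dm(2)[rule_format, of t k] k t(3) \<theta>(3) V[of k] by (simp add: algebra_simps)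
      then have "\<sigma> * (real x + 1 / 2) = real_of_int (V k) + d k * \<theta>"
        using assms(1) by simp
      moreover have "real_of_int (V (Suc k)) = real_of_int (V k) + d k"
        by (simp add: V_def fd)
      ultimately have "real_of_int (min (U k) (U (Suc k))) \<le> real x + 1 / 2"
        "real x - 1 / 2 \<le> real_of_int (min (U k) (U (Suc k)))"
        using \<sigma> d[of k] \<theta>(1,2) by (auto simp: min_def)
      then have "min (U k) (U (Suc k)) = int x" by linarith
      moreover have "real k \<le> \<tau> / \<epsilon>"
        using k(2) t(1) assms(1) by (simp add: field_simps)
      then have "k < T" unfolding T_def by (simp add: le_floor_iff le_nat_iff less_Suc_eq_le)
      ultimately show ?thesis using k(1) by blast
    qed
    then have "{..<p} \<subseteq> m ` {k. k < T \<and> min (U k) (U (Suc k)) = int x}" by blast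
    then have "card {..<p} \<le> crossings U x T"
      unfolding crossings_def by (rule surj_card_le[rotated]) simp
    then show "\<exists>T. real T \<le> \<tau> / \<epsilon> + 1 \<and> p \<le> crossings U x T" using T by auto
  qed
qed

lemma explored_before:
  assumes alg: "search_algorithm p A" and ratio: "competitive_ratio p A < ereal c" and x: "1 \<le> \<bar>x\<bar>"
    and i: "i < p"
  shows "\<exists>s\<le>c * \<bar>x\<bar>. passes A i x s"
proof -
  have "ereal (competitive_ratio_at p A x) \<le> competitive_ratio p A"
    unfolding competitive_ratio_def by (rule SUP_upper) simp
  then have "competitive_ratio_at p A x < c"
    using ratio le_less_trans less_ereal.simps(1) by blast
  then have "Inf {t. 0 \<le> t \<and> explored p A x t} < c * \<bar>x\<bar>"
    using x by (simp add: competitive_ratio_at_def exploration_time_def pos_divide_less_eq)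
  \<comment> \<open>Finite exploration times exclude the infimum of the empty set.\<close>
  moreover have "{t. 0 \<le> t \<and> explored p A x t} \<noteq> {}"
    using alg unfolding search_algorithm_def by auto
  ultimately have "\<exists>t\<in>{t. 0 \<le> t \<and> explored p A x t}. t < c * \<bar>x\<bar>"
    by (rule cInf_lessD[rotated])
  then obtain t where t: "t < c * \<bar>x\<bar>" "explored p A x t" by blast
  then obtain s where "s \<le> t" "passes A i x s"
    using x i unfolding explored_def by auto
  then show ?thesis using t(1) by (intro exI[of _ s]) simp
qed

theorem theorem4:
  fixes p :: nat
  assumes "p \<ge> 2" and "even p"
  shows "(\<exists>!c. c \<in> {2 * real p + 1 + sqrt (8 * real p)..} \<and> D_poly p c = 0) \<and>
    \<not> (\<exists>A. search_algorithm p A \<and> competitive_ratio p A < ereal (c_star p))"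
proof (intro conjI notI)
  have p: "p > 0" using assms by simp
  show "\<exists>!c. c \<in> {c_min p..} \<and> D_poly p c = 0" using ex1_D_poly_root[OF p] .
  assume "\<exists>A. search_algorithm p A \<and> competitive_ratio p A < ereal (c_star p)"
  then obtain A where A: "search_algorithm p A" "competitive_ratio p A < ereal (c_star p)" by blast
  obtain r where r: "competitive_ratio p A < ereal r" "r < c_star p"
    using ereal_dense2[OF A(2)] by auto
  define a where "a = max r (c_min p)"
  have a: "competitive_ratio p A < ereal a" "a < c_star p" "c_min p \<le> a"
    using r c_star(1)[OF p] less_le_trans[OF r(1), of "ereal a"] by (simp_all add: a_def)
  \<comment> \<open>The gap is cut into thirds: \<open>a\<close> bounds the algorithm,
    \<open>a + h\<close> the deadlines of the discrete walk, and \<open>c\<close> the trips.\<close>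
  define h where "h = (c_star p - a) / 3"
  define c where "c = a + 2 * h"
  have h: "h > 0" "c < c_star p" "c_min p \<le> c" using a by (auto simp: h_def c_def field_simps)
  have ap: "real p + 1 < a"
    using a(3) p by (intro less_le_trans[OF _ a(3)]) (simp add: add_pos_nonneg)
  have ac: "real p + 1 < c" using ap h(1) by (simp add: c_def)
  obtain \<delta> where \<delta>: "\<delta> > 0" "ratio_contracts p c \<delta>"
    by (rule ratio_decrease[OF p ac c_star(2)[OF p h(3,2)]])
  obtain N where N: "(c + 1) / 2 < real N * \<delta>" using reals_Archimedean3[OF \<delta>(1)] by blast
  define n where "n = N + p + 1"
  \<comment> \<open>The midpoints considered have modulus at most
    \<open>2 * c ^ (n + 1) + 1\<close>, because \<open>\<epsilon> * real M \<le> 2\<close>.\<close>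
  define H where "H = a * (2 * c ^ (n + 1) + 1)"
  \<comment> \<open>The second bound pays for the midpoint shift and the extra step, the third for
    the rounding term \<open>p\<close>.\<close>
  define \<epsilon>\<^sub>0 where "\<epsilon>\<^sub>0 = min 1 (min (h / (a + 2)) (h / real p))"
  have H: "H > 0" using ap ac by (auto simp: H_def intro!: mult_pos_pos add_nonneg_pos)
  have \<epsilon>\<^sub>0: "\<epsilon>\<^sub>0 > 0" using h ap p by (simp add: \<epsilon>\<^sub>0_def)
  have "\<forall>\<^sub>F \<epsilon> in at_right (0::real). 0 < \<epsilon> \<and> \<epsilon> < \<epsilon>\<^sub>0"
    using \<epsilon>\<^sub>0 by (auto simp: eventually_at_right_field)
  moreover have "\<forall>\<^sub>F \<epsilon> in at_right 0. \<exists>Q. discrete_pattern p \<epsilon> Q \<and> approximates H (h / 2) Q A"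
    using A(1) H h unfolding search_algorithm_def valid_pattern_def by simp
  ultimately have "\<forall>\<^sub>F \<epsilon> in at_right 0. (0 < \<epsilon> \<and> \<epsilon> < \<epsilon>\<^sub>0) \<and>
      (\<exists>Q. discrete_pattern p \<epsilon> Q \<and> approximates H (h / 2) Q A)"
    by (rule eventually_conj)
  then have "\<exists>\<epsilon>. (0 < \<epsilon> \<and> \<epsilon> < \<epsilon>\<^sub>0) \<and> (\<exists>Q. discrete_pattern p \<epsilon> Q \<and> approximates H (h / 2) Q A)"
    by (rule eventually_happens'[OF trivial_limit_at_right_real])
  then obtain \<epsilon> Q where \<epsilon>: "0 < \<epsilon>" "\<epsilon> < \<epsilon>\<^sub>0" and Q: "discrete_pattern p \<epsilon> Q"
    "approximates H (h / 2) Q A"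
    by blast
  have \<epsilon>b: "\<epsilon> < 1" "a + 2 \<le> h / \<epsilon>" "real p \<le> h / \<epsilon>"
    using \<epsilon> h ap p by (auto simp: \<epsilon>\<^sub>0_def field_simps)
  \<comment> \<open>The midpoints of all cells from \<open>M\<close> on are thus at distance at
    least 1, where the ratio yields a deadline.\<close>
  define M where "M = nat \<lceil>1 / \<epsilon>\<rceil>"
  have M: "1 / \<epsilon> \<le> real M" "real M \<le> 1 / \<epsilon> + 1" "M > 0"
    using \<epsilon> by (auto simp: M_def)
  interpret frontier_walk p M using assms M by unfold_locales auto
  obtain V where V: "unit_walk V" and cross:
    "\<forall>\<sigma> U x \<tau>. (\<sigma> = 1 \<and> U = V \<or> \<sigma> = -1 \<and> U = - V) \<and>
      (\<forall>i<p. \<exists>t\<le>\<tau>. passes Q i (\<sigma> * (\<epsilon> * (real x + 1 / 2))) t) \<longrightarrow>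
      (\<exists>T. real T \<le> \<tau> / \<epsilon> + 1 \<and> p \<le> crossings U x T)"
    by (rule discrete_pattern_crossings[OF \<epsilon>(1) p Q(1)])
  show False
  proof (rule no_fast_walk[OF V _ _ _ _ \<delta>(2,1), of "a + h"])
    show "1 \<le> a + h" "a + h \<le> c" using ap h by (auto simp: c_def)
    have "h / \<epsilon> \<le> h * real M" using mult_left_mono[OF M(1), of h] h by simp
    then show "real p \<le> (c - (a + h)) * real M" using \<epsilon>b(3) by (simp add: c_def)
    show "p < n" by (simp add: n_def)
    show "(c + 1) / 2 \<le> (real n - real p - 1) * \<delta>" using N by (simp add: n_def)
    fix U x
    assume U: "U \<in> {V, - V}" and x: "M \<le> x" "real x \<le> c ^ (n + 1) * real M"
    obtain \<sigma> :: real where \<sigma>: "\<sigma> = 1 \<and> U = V \<or> \<sigma> = -1 \<and> U = - V" using U by auto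
    define y where "y = \<sigma> * (\<epsilon> * (real x + 1 / 2))"
    have y: "\<bar>y\<bar> = \<epsilon> * (real x + 1 / 2)" using \<sigma> \<epsilon>(1) by (auto simp: y_def abs_mult)
    have x1: "1 / \<epsilon> \<le> real x" using M(1) x(1) by linarith
    then have y1: "1 \<le> \<bar>y\<bar>" unfolding y using \<epsilon>(1) by (simp add: field_simps)
    have "\<epsilon> * real M \<le> 2" using M(2) \<epsilon>(1) \<epsilon>b(1) mult_left_mono[OF M(2), of \<epsilon>] by (simp add: distrib_left)
    then have "c ^ (n + 1) * (\<epsilon> * real M) \<le> c ^ (n + 1) * 2" using ac by (intro mult_left_mono) auto
    moreover have "\<epsilon> * real x \<le> \<epsilon> * (c ^ (n + 1) * real M)" using x(2) \<epsilon>(1) by (intro mult_left_mono) auto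
    ultimately have "\<bar>y\<bar> \<le> 2 * c ^ (n + 1) + 1" unfolding y using \<epsilon>b(1) by (simp add: algebra_simps)
    then have yH: "a * \<bar>y\<bar> \<le> H" unfolding H_def using ap by (intro mult_left_mono) auto
    have "\<exists>t\<le>a * \<bar>y\<bar> + h / 2. passes Q i y t" if i: "i < p" for i
    proof -
      obtain s where s: "s \<le> a * \<bar>y\<bar>" "passes A i y s"
        using explored_before[OF A(1) a(1) y1 i] by blast
      then have "s \<in> {0..H}" using yH by (auto simp: passes_def)
      then obtain t where t: "\<bar>t - s\<bar> \<le> h / 2" "passes Q i y t"
        using Q(2) s(2) unfolding approximates_def by blast
      have "t \<le> a * \<bar>y\<bar> + h / 2" using s(1) t(1) by linarith
      then show ?thesis using t(2) by blast
    qed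
    then obtain T where T: "real T \<le> (a * \<bar>y\<bar> + h / 2) / \<epsilon> + 1" "p \<le> crossings U x T"
      using cross[rule_format, of \<sigma> U "a * \<bar>y\<bar> + h / 2" x] \<sigma> unfolding y_def by blast
    have "(a * \<bar>y\<bar> + h / 2) / \<epsilon> + 1 = a * real x + (a + 2) / 2 + (h / \<epsilon>) / 2"
      unfolding y using \<epsilon>(1) by (simp add: field_simps)
    \<comment> \<open>Half of \<open>h / \<epsilon>\<close> is the time tolerance; the other half
      covers \<open>(a + 2) / 2\<close>.\<close>
    also have "\<dots> \<le> a * real x + h / \<epsilon>"
    proof -
      have "u / 2 + z / 2 \<le> z" if "u \<le> z" for u z :: real using that by simp
      from this[OF \<epsilon>b(2)] show ?thesis by simp
    qed
    also have "\<dots> \<le> (a + h) * real x"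
      using mult_left_mono[OF x1, of h] h by (simp add: distrib_right)
    finally show "\<exists>T. real T \<le> (a + h) * real x \<and> p \<le> crossings U x T" using T by (intro exI[of _ T]) auto
  qed
qed

end
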